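(* Let $T$ be a reduced tree. Then $T$ is well-ve-dominated if and only if one of the following holds: (1) $T\in\{P_1,P_2\}$; (2) $T$ is obtained from a tree $H$ of order at least two by attaching a pendant path of length two to each vertex of $H$.
   Context: All graphs are finite, simple and undirected. A vertex $v$ ve-dominates an edge $e$ if at least one endpoint of $e$ belongs to the closed neighborhood $N_G[v]$. A set $D\subseteq V(G)$ is a ve-dominating set if every edge of $G$ is ve-dominated by some vertex of $D$; it is minimal if no proper subset is ve-dominating. $G$ is well-ve-dominated if all its minimal ve-dominating sets have the same cardinality. Two distinct vertices $x,y$ are false twins if their open neighborhoods coincide, $N_G(x)=N_G(y)$; a graph is reduced if it has no false twins. $P_n$ is the path on $n$ vertices (trees are identified up to isomorphism). Attaching a pendant path of length two to each vertex of $H$ means: for every $w\in V(H)$ add two new vertices $c_w,\ell_w$ and the edges $wc_w$ and $c_w\ell_w$. *)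

theory Defs
  imports
    "Graph_Theory.Pair_Digraph"
    "Graph_Theory.Digraph_Component"
    "Graph_Theory.Digraph_Isomorphism"
begin

text \<open>
  A finite simple undirected graph is a \<^locale>\<open>pair_graph\<close>: every undirected edge is
  represented by the two ordered pairs of its endpoints.
\<close>

text \<open>
  Graph_Theory's own \<open>tree\<close> is unsuitable here: in a symmetric digraph every edge, traversed
  back and forth, is a cycle of length two.  A cycle of an undirected graph is
  therefore one of length at least three.
\<close>
definition undirected_tree :: "'a pair_pre_digraph \<Rightarrow> bool" where
  "undirected_tree G \<longleftrightarrow>
     pair_graph G \<and> Digraph_Component.connected (with_proj G) \<and>
     \<not> (\<exists>p. pre_digraph.cycle (with_proj G) p \<and> 3 \<le> length p)"

definition open_neighborhood :: "'a pair_pre_digraph \<Rightarrow> 'a \<Rightarrow> 'a set" where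
  "open_neighborhood G v = {u. (v, u) \<in> parcs G}"

definition closed_neighborhood :: "'a pair_pre_digraph \<Rightarrow> 'a \<Rightarrow> 'a set" where
  "closed_neighborhood G v = insert v (open_neighborhood G v)"

definition ve_dominates :: "'a pair_pre_digraph \<Rightarrow> 'a \<Rightarrow> 'a \<times> 'a \<Rightarrow> bool" where
  "ve_dominates G v e \<longleftrightarrow>
     fst e \<in> closed_neighborhood G v \<or> snd e \<in> closed_neighborhood G v"

definition ve_dominating_set :: "'a pair_pre_digraph \<Rightarrow> 'a set \<Rightarrow> bool" where
  "ve_dominating_set G D \<longleftrightarrow>
     D \<subseteq> pverts G \<and> (\<forall>e \<in> parcs G. \<exists>v \<in> D. ve_dominates G v e)"

definition minimal_ve_dominating_set :: "'a pair_pre_digraph \<Rightarrow> 'a set \<Rightarrow> bool" where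
  "minimal_ve_dominating_set G D \<longleftrightarrow>
     ve_dominating_set G D \<and> (\<forall>D'. D' \<subset> D \<longrightarrow> \<not> ve_dominating_set G D')"

definition well_ve_dominated :: "'a pair_pre_digraph \<Rightarrow> bool" where
  "well_ve_dominated G \<longleftrightarrow>
     (\<forall>D D'. minimal_ve_dominating_set G D \<longrightarrow> minimal_ve_dominating_set G D' \<longrightarrow>
        card D = card D')"

definition false_twins :: "'a pair_pre_digraph \<Rightarrow> 'a \<Rightarrow> 'a \<Rightarrow> bool" where
  "false_twins G x y \<longleftrightarrow>
     x \<in> pverts G \<and> y \<in> pverts G \<and> x \<noteq> y \<and> open_neighborhood G x = open_neighborhood G y"

definition reduced :: "'a pair_pre_digraph \<Rightarrow> bool" where
  "reduced G \<longleftrightarrow> \<not> (\<exists>x y. false_twins G x y)"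

definition path_graph :: "nat \<Rightarrow> nat pair_pre_digraph" where
  "path_graph n =
     \<lparr> pverts = {..<n}, parcs = {(i, j). i < n \<and> j < n \<and> (j = Suc i \<or> i = Suc j)} \<rparr>"

datatype 'a attached_vertex = Base 'a | Mid 'a | Leaf 'a

text \<open>
  \<open>Base w\<close> is the vertex \<open>w\<close> of \<open>H\<close>; \<open>Mid w\<close> and \<open>Leaf w\<close> are the new vertices
  $c_w$ and $\ell_w$.
\<close>
definition attach_pendant_P2 :: "'a pair_pre_digraph \<Rightarrow> 'a attached_vertex pair_pre_digraph" where
  "attach_pendant_P2 H =
     \<lparr> pverts = Base ` pverts H \<union> Mid ` pverts H \<union> Leaf ` pverts H,
       parcs = {(Base u, Base v) | u v. (u, v) \<in> parcs H} \<union>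
         (\<Union>w \<in> pverts H. {(Base w, Mid w), (Mid w, Base w), (Mid w, Leaf w), (Leaf w, Mid w)}) \<rparr>"

text \<open>
  Taking the vertices of \<open>H\<close> from the vertex type of \<open>T\<close> loses nothing: \<open>H\<close> is isomorphic to a
  subgraph of \<open>T\<close>.
\<close>
definition pendant_P2_attachment_of_tree :: "'a pair_pre_digraph \<Rightarrow> bool" where
  "pendant_P2_attachment_of_tree T \<longleftrightarrow>
     (\<exists>H :: 'a pair_pre_digraph. undirected_tree H \<and> 2 \<le> card (pverts H) \<and>
        digraph_iso (with_proj T) (with_proj (attach_pendant_P2 H)))"

end

theory Submission
  imports Defs
begin

text \<open>
  A vertex dominates the edge $uv$ iff it lies in $N[u] \cup N[v]$, the hood of $uv$; so the
  ve-dominating sets are the transversals of the hoods.  In a tree every hood is a subtree, and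
  subtrees of a tree can be packed as densely as they can be hit: choosing greedily from the bottom
  of the rooted tree gives edges with pairwise disjoint hoods and a transversal with at most as many
  vertices (lemma \<open>hood_packing\<close>).
  
  Let \<open>T\<close> be well-ve-dominated with at least one edge.  Comparing cardinalities, every minimal
  ve-dominating set has exactly one vertex in each packed hood and none elsewhere
  (\<open>minimal_sets_are_packing_representatives\<close>).  Every vertex belongs to some minimal
  ve-dominating set (\<open>vertex_in_minimal_set\<close>), so the packed hoods partition the vertices.
  On the other hand some pairs of vertices are contained in one minimal set: a further neighbour of
  \<open>u\<close> with a further neighbour of \<open>v\<close> for an edge $uv$, and two neighbours of the same vertex when
  neither is a leaf.  Such a pair cannot lie in one packed hood.  Hence a packed edge is a pendant
  edge $c\ell$ whose support \<open>c\<close> has at most one neighbour that is not a leaf; as a reduced tree has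
  no two leaves at the same vertex, the packed hood is $\{c, \ell\}$ or $\{w, c, \ell\}$ with
  \<open>c\<close> of degree two (\<open>pendant_edge_if_one_representative\<close>).  In the first case \<open>T\<close> is $P_2$.
  If all packed hoods are of the second kind, only the vertices \<open>w\<close> have neighbours outside their own
  hood, so \<open>T\<close> arises from the tree induced on them by attaching the pendant paths.
  
  Conversely, in a block $\{w, c, \ell\}$ of such an attachment every edge dominated by $\ell$ is
  dominated by \<open>c\<close>, and every edge dominated by \<open>c\<close> is dominated by \<open>w\<close>.  A minimal ve-dominating
  set therefore has at most one vertex in each block; it has at least one, because the block is the
  hood of $c\ell$.  So its size is the number of blocks (\<open>card_minimal_set_pendant_blocks\<close>).
\<close>

section \<open>Trees, depth and walks without backtracking\<close>

text \<open>
  Walks that never return at once along the edge just used.  In a tree they are exactly the paths,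
  but the defining condition is local, so it can be checked on a list whose entries are not all known
  to be distinct.
\<close>

fun nonbacktracking :: "'a rel \<Rightarrow> 'a list \<Rightarrow> bool" where
  "nonbacktracking E (x # y # z # ws) \<longleftrightarrow> (x, y) \<in> E \<and> x \<noteq> z \<and> nonbacktracking E (y # z # ws)"
| "nonbacktracking E [x, y] \<longleftrightarrow> (x, y) \<in> E"
| "nonbacktracking E _ \<longleftrightarrow> True"

lemma nonbacktracking_ConsD: "nonbacktracking E (x # ws) \<Longrightarrow> nonbacktracking E ws"
  by (cases ws rule: nonbacktracking.cases[of "(E, ws)" for ws, simplified]) (auto elim: nonbacktracking.elims)

lemma nonbacktracking_snocD: "nonbacktracking E (ws @ [x]) \<Longrightarrow> nonbacktracking E ws"
  by (induction E ws rule: nonbacktracking.induct) auto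

lemma nonbacktracking_nth_edge:
  "nonbacktracking E ws \<Longrightarrow> Suc i < length ws \<Longrightarrow> (ws ! i, ws ! Suc i) \<in> E"
  by (induction E ws arbitrary: i rule: nonbacktracking.induct) (auto simp: nth_Cons split: nat.splits)

lemma nonbacktracking_nth_neq:
  "nonbacktracking E ws \<Longrightarrow> Suc (Suc i) < length ws \<Longrightarrow> ws ! i \<noteq> ws ! Suc (Suc i)"
  by (induction E ws arbitrary: i rule: nonbacktracking.induct) (auto simp: nth_Cons split: nat.splits)

text \<open>
  A path from \<open>a\<close> to \<open>b\<close> that avoids \<open>v\<close> closes up through \<open>v\<close>; it has at least one arc because
  \<open>a\<close> and \<open>b\<close> differ, which makes the cycle long enough to count as a cycle of an undirected graph.
\<close>

lemma (in pair_wf_digraph) cycle_through_vertex: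
  assumes "(v, a) \<in> parcs G" "(b, v) \<in> parcs G" "a \<noteq> b"
    and reach: "a \<rightarrow>\<^sup>*\<^bsub>del_vert v\<^esub> b"
  shows "\<exists>p. cycle p \<and> 3 \<le> length p"
proof -
  interpret D: wf_digraph "del_vert v" by (rule wf_digraph_del_vert)
  obtain p where p: "pre_digraph.apath (del_vert v) a p b"
    using reach D.reachable_apath by blast
  have ap: "apath a p b"
    using subgraph_apath_imp_apath[OF p subgraph_del_vert] .
  have "pre_digraph.awalk_verts (del_vert v) = pre_digraph.awalk_verts (with_proj G)"
    by (rule compatible_awalk_verts) (simp add: compatible_def del_vert_simps)
  moreover have "set (pre_digraph.awalk_verts (del_vert v) a p) \<subseteq> verts (del_vert v)"
    using p unfolding D.apath_def by blast
  ultimately have v: "v \<notin> set (pawalk_verts a p)"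
    by (auto simp: verts_del_vert)
  have verts_snoc: "pawalk_verts x (q @ [(b, v)]) = pawalk_verts x q @ [v]"
    if "awalk x q b" for x q
    using that by (induction q arbitrary: x) (auto simp: awalk_simps)
  have "p \<noteq> []" using ap \<open>a \<noteq> b\<close> by (auto simp: apath_Nil_iff)
  let ?q = "(v, a) # p @ [(b, v)]"
  have "awalk v ?q v"
    using assms ap by (auto simp: awalk_simps apath_def wellformed')
  moreover have "pawalk_verts a (p @ [(b, v)]) = pawalk_verts a p @ [v]"
    using ap verts_snoc[of a p] unfolding apath_def by blast
  then have "distinct (tl (pawalk_verts v ?q))"
    using ap v by (simp add: apath_def)
  moreover have "3 \<le> length ?q" using \<open>p \<noteq> []\<close> by (cases p) auto
  ultimately show ?thesis unfolding cycle_def by blast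
qed

lemma (in pair_sym_digraph) connected_iff_rtrancl:
  "Digraph_Component.connected (with_proj G) \<longleftrightarrow>
     pverts G \<noteq> {} \<and> (\<forall>u \<in> pverts G. \<forall>v \<in> pverts G. (u, v) \<in> (parcs G)\<^sup>*)"
proof -
  have sym: "(\<Union>e\<in>parcs G. {e, (snd e, fst e)}) = parcs G"
    using arcs_symmetric by auto
  have "(u, v) \<in> rtrancl_on (pverts G) (parcs G) \<longleftrightarrow> (u, v) \<in> (parcs G)\<^sup>*"
    if "u \<in> pverts G" "v \<in> pverts G" for u v
    using that
    by (auto intro: rtrancl_on_rtranclI rtrancl_consistent_rtrancl_on wellformed')
  then show ?thesis
    by (simp add: connected_def strongly_connected_def reachable_def mk_symmetric_def sym)
qed

locale simple_tree =
  fixes T :: "'a pair_pre_digraph"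
  assumes undirected_tree: "undirected_tree T"

sublocale simple_tree \<subseteq> pair_graph T
  using undirected_tree by (simp add: undirected_tree_def)

context simple_tree begin

abbreviation nbhd :: "'a \<Rightarrow> 'a set" where
  "nbhd \<equiv> open_neighborhood T"

abbreviation cnbhd :: "'a \<Rightarrow> 'a set" where
  "cnbhd \<equiv> closed_neighborhood T"

lemma arc_neq: "(u, v) \<in> parcs T \<Longrightarrow> u \<noteq> v"
  using no_loops' by blast

lemma rtrancl_verts: "u \<in> pverts T \<Longrightarrow> v \<in> pverts T \<Longrightarrow> (u, v) \<in> (parcs T)\<^sup>*"
  using undirected_tree by (simp add: undirected_tree_def connected_iff_rtrancl)

lemma verts_nonempty: "pverts T \<noteq> {}"
  using undirected_tree by (simp add: undirected_tree_def connected_iff_rtrancl)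

lemma neighbour_unique_if_reachable_avoiding:
  assumes "(v, a) \<in> parcs T" "(v, b) \<in> parcs T" "a \<rightarrow>\<^sup>*\<^bsub>del_vert v\<^esub> b"
  shows "a = b"
  using cycle_through_vertex[of v a b] assms undirected_tree arcs_symmetric
  by (auto simp: undirected_tree_def)

text \<open>
  The form in which acyclicity is used from here on: every edge joins a vertex to its parent in a
  rooted tree.  The depth is the distance from an arbitrary root; two neighbours that are no farther
  from the root than the vertex itself would give two ways to the root and hence a cycle.
\<close>

lemma depth_function:
  obtains d :: "'a \<Rightarrow> nat" and parent :: "'a \<Rightarrow> 'a" where
    "\<And>u v. (u, v) \<in> parcs T \<Longrightarrow>
       d v < d u \<and> v = parent u \<or> d u < d v \<and> u = parent v"
proof -
  obtain r where r: "r \<in> pverts T" using verts_nonempty by blast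
  define d where "d v = (LEAST n. (r, v) \<in> parcs T ^^ n)" for v
  have ex: "\<exists>n. (r, v) \<in> parcs T ^^ n" if "v \<in> pverts T" for v
    using rtrancl_verts[OF r that] by (simp add: rtrancl_power)
  have down: "\<exists>u. (u, v) \<in> parcs T \<and> d u < d v" if v: "v \<in> pverts T" and "v \<noteq> r" for v
  proof -
    have mem: "(r, v) \<in> parcs T ^^ d v"
      unfolding d_def by (rule LeastI_ex) (rule ex[OF v])
    then obtain n where n: "d v = Suc n"
      using \<open>v \<noteq> r\<close> by (cases "d v") auto
    then obtain u where u: "(r, u) \<in> parcs T ^^ n" "(u, v) \<in> parcs T"
      using mem by auto
    have "d u \<le> n" unfolding d_def using u(1) by (rule Least_le)
    then show ?thesis using u n by auto
  qed
  have dr: "d r = 0" unfolding d_def by (rule Least_eq_0) simp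
  have d0: "v = r" if "v \<in> pverts T" "d v = 0" for v
    using down[OF that(1)] that(2) by fastforce
  \<comment> \<open>A shortest way to the root from a vertex no deeper than \<open>v\<close> does not meet \<open>v\<close>.\<close>
  have avoid: "x \<rightarrow>\<^sup>*\<^bsub>del_vert v\<^esub> r"
    if "x \<in> pverts T" "x \<noteq> v" "d x \<le> d v" "v \<noteq> r" for x v
    using that(1-3)
  proof (induction "d x" arbitrary: x rule: less_induct)
    case less
    interpret D: wf_digraph "del_vert v" by (rule wf_digraph_del_vert)
    show ?case
    proof (cases "x = r")
      case True
      then show ?thesis using less.prems by (auto simp: verts_del_vert)
    next
      case False
      then obtain u where u: "(u, x) \<in> parcs T" "d u < d x"
        using down less.prems by blast
      then have "u \<rightarrow>\<^sup>*\<^bsub>del_vert v\<^esub> r"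
        using less.hyps[of u] less.prems by (force dest: wellformed')
      moreover have "x \<rightarrow>\<^bsub>del_vert v\<^esub> u"
        using u less.prems arcs_symmetric[OF u(1)]
        by (auto simp: arcs_ends_conv del_vert_simps image_iff)
      ultimately show ?thesis by (rule D.adj_reachable_trans[rotated])
    qed
  qed
  have unique: "a = b"
    if "(v, a) \<in> parcs T" "(v, b) \<in> parcs T" "d a \<le> d v" "d b \<le> d v" for v a b
  proof -
    interpret D: wf_digraph "del_vert v" by (rule wf_digraph_del_vert)
    have "v \<noteq> r"
      using that arc_neq[OF that(1)] d0[of a] dr by (auto dest: wellformed')
    have "a \<rightarrow>\<^sup>*\<^bsub>del_vert v\<^esub> r" "b \<rightarrow>\<^sup>*\<^bsub>del_vert v\<^esub> r"
      using that \<open>v \<noteq> r\<close> arc_neq by (auto intro!: avoid dest: wellformed')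
    moreover have "symmetric (del_vert v)"
      unfolding symmetric_conv using arcs_symmetric
      by (fastforce simp: del_vert_simps)
    ultimately have "a \<rightarrow>\<^sup>*\<^bsub>del_vert v\<^esub> b"
      by (meson D.reachable_trans symmetric_reachable)
    then show ?thesis using that neighbour_unique_if_reachable_avoiding by blast
  qed
  define parent where "parent v = (THE u. (v, u) \<in> parcs T \<and> d u < d v)" for v
  have parent: "parent v = u" if "(v, u) \<in> parcs T" "d u < d v" for u v
    unfolding parent_def using that unique by (intro the_equality) (auto intro: less_imp_le)
  have "d u \<noteq> d v" if uv: "(u, v) \<in> parcs T" for u v
  proof
    assume eq: "d u = d v"
    have "u \<noteq> r"
      using eq dr d0[of v] uv arc_neq[OF uv] by (auto dest: wellformed')
    then obtain w where "(w, u) \<in> parcs T" "d w < d u"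
      using down uv by (auto dest: wellformed')
    then show False
      using unique[of u v w] uv eq arcs_symmetric by fastforce
  qed
  then show ?thesis
    using parent arcs_symmetric by (intro that[of d parent]) (metis nat_neq_iff)
qed

text \<open>
  At an inner vertex of maximal depth both walk neighbours would be its parent, which is a
  backtracking step.  So on a closed walk the maximum is attained at the common end, whose
  two walk neighbours are again its parent; cutting off both ends leaves a shorter closed walk.
\<close>

lemma nonbacktracking_hd_neq_last:
  assumes "nonbacktracking (parcs T) ws" "2 \<le> length ws"
  shows "hd ws \<noteq> last ws"
proof -
  obtain d parent where d: "\<And>u v. (u, v) \<in> parcs T \<Longrightarrow>
       d v < d u \<and> v = parent u \<or> (d u :: nat) < d v \<and> u = parent v"
    using depth_function by blast
  show ?thesis using assms
  proof (induction "length ws" arbitrary: ws rule: less_induct)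
    case less
    note nb = less.prems(1)
    let ?n = "length ws"
    show ?case
    proof
      assume closed: "hd ws = last ws"
      then have ends: "ws ! 0 = ws ! (?n - 1)"
        using less.prems(2) by (cases "ws = []") (auto simp: hd_conv_nth last_conv_nth)
      have "?n \<noteq> 2"
        using arc_neq[OF nonbacktracking_nth_edge[OF nb, of 0]] ends by auto
      moreover have "?n \<noteq> 3"
        using nonbacktracking_nth_neq[OF nb, of 0] ends by (auto simp: numeral_2_eq_2)
      ultimately have n: "4 \<le> ?n" using less.prems(2) by linarith
      let ?M = "Max (d ` set ws)"
      have "ws \<noteq> []" using n by auto
      then have "?M \<in> d ` set ws" by (intro Max_in) auto
      then obtain i where i: "i < ?n" "d (ws ! i) = ?M"
        by (metis imageE in_set_conv_nth)
      have le: "d (ws ! j) \<le> d (ws ! i)" if "j < ?n" for j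
        using i that by auto
      have up: "ws ! Suc j = parent (ws ! j)" if "Suc j < ?n" "ws ! j = ws ! i" for j
        using d[OF nonbacktracking_nth_edge[OF nb that(1)]] le[of "Suc j"] that by auto
      have dn: "ws ! j = parent (ws ! Suc j)" if "Suc j < ?n" "ws ! Suc j = ws ! i" for j
        using d[OF nonbacktracking_nth_edge[OF nb that(1)]] le[of j] that by auto
      show False
      proof (cases "0 < i \<and> i < ?n - 1")
        case True
        then obtain j where j: "i = Suc j" by (cases i) auto
        have n': "Suc (Suc j) < ?n" using True j by linarith
        have "ws ! Suc (Suc j) = parent (ws ! Suc j)" "ws ! j = parent (ws ! Suc j)"
          using up[of "Suc j"] dn[of j] n' j by simp_all
        then show False
          using nonbacktracking_nth_neq[OF nb n'] by simp
      next
        case False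
        then have "i = 0 \<or> i = ?n - 1" using i(1) by linarith
        then have top: "ws ! 0 = ws ! i" "ws ! (?n - 1) = ws ! i"
          using ends by auto
        \<comment> \<open>Both equal the parent of the common end, so the walk without its ends is closed as well.\<close>
        have "ws ! Suc 0 = ws ! (?n - 2)"
          using up[of 0] dn[of "?n - 2"] top n by (simp add: Suc_diff_Suc numeral_2_eq_2)
        obtain x zs where "ws = x # zs" using n by (cases ws) auto
        moreover obtain ys y where "zs = ys @ [y]"
          using n calculation by (cases zs rule: rev_cases) auto
        ultimately have ws: "ws = x # ys @ [y]" by simp
        have ys: "2 \<le> length ys" using n ws by simp
        have "ws ! Suc 0 = hd ys" "ws ! (?n - 2) = last ys"
          using ys by (auto simp: ws nth_append hd_conv_nth last_conv_nth nth_Cons' split: nat.splits)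
        moreover have "nonbacktracking (parcs T) ys"
          using nb ws nonbacktracking_ConsD nonbacktracking_snocD by metis
        ultimately show False
          using less.hyps[of ys] ys \<open>ws ! Suc 0 = ws ! (?n - 2)\<close> ws by auto
      qed
    qed
  qed
qed

lemma nonbacktracking_ends_not_adjacent:
  assumes nb: "nonbacktracking (parcs T) ws" and len: "3 \<le> length ws"
  shows "(hd ws, last ws) \<notin> parcs T"
proof
  assume e: "(hd ws, last ws) \<in> parcs T"
  obtain x y zs where ws: "ws = x # y # zs" "zs \<noteq> []"
    using len by (cases ws rule: nonbacktracking.cases[of "(E, ws)" for ws, simplified]) auto
  have "y \<noteq> last zs"
    using nonbacktracking_hd_neq_last[OF nonbacktracking_ConsD[OF nb[unfolded ws(1)]]] ws
    by (cases zs) auto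
  then have "nonbacktracking (parcs T) (last ws # ws)"
    using nb e ws arcs_symmetric by auto
  from nonbacktracking_hd_neq_last[OF this] show False using ws by auto
qed

end

section \<open>Ve-domination as a transversal problem\<close>

definition edge_hood :: "'a pair_pre_digraph \<Rightarrow> 'a \<times> 'a \<Rightarrow> 'a set" where
  "edge_hood G e = closed_neighborhood G (fst e) \<union> closed_neighborhood G (snd e)"

context pair_pseudo_graph begin

lemma ve_dominates_iff: "ve_dominates G v e \<longleftrightarrow> v \<in> edge_hood G e"
  using arcs_symmetric
  by (auto simp: ve_dominates_def edge_hood_def closed_neighborhood_def open_neighborhood_def)

lemma ve_dominating_set_iff:
  "ve_dominating_set G D \<longleftrightarrow> D \<subseteq> pverts G \<and> (\<forall>e \<in> parcs G. D \<inter> edge_hood G e \<noteq> {})"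
  by (auto simp: ve_dominating_set_def ve_dominates_iff)

lemma edge_hood_subset: "e \<in> parcs G \<Longrightarrow> edge_hood G e \<subseteq> pverts G"
  by (auto simp: edge_hood_def closed_neighborhood_def open_neighborhood_def
      dest: arc_fst_in_verts arc_snd_in_verts wellformed')

lemma minimal_ve_dominating_subset:
  assumes "ve_dominating_set G D"
  obtains D' where "D' \<subseteq> D" "minimal_ve_dominating_set G D'"
proof -
  obtain D' where D': "D' \<subseteq> D \<and> ve_dominating_set G D'"
    and least: "\<And>C. C \<subseteq> D \<and> ve_dominating_set G C \<Longrightarrow> card D' \<le> card C"
    using assms ex_has_least_nat[of "\<lambda>C. C \<subseteq> D \<and> ve_dominating_set G C" D card] by blast
  have "finite D'"
    using D' finite_subset[OF _ pair_finite_verts] by (simp add: ve_dominating_set_def)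
  have "\<not> ve_dominating_set G C" if "C \<subset> D'" for C
    using least[of C] D' that psubset_card_mono[OF \<open>finite D'\<close> that] by auto
  then have "minimal_ve_dominating_set G D'"
    unfolding minimal_ve_dominating_set_def using D' by blast
  then show ?thesis using that D' by blast
qed

text \<open>
  The edge is private to \<open>x\<close>: it is the witness that \<open>x\<close> cannot be removed.
\<close>

lemma minimal_ve_dominating_setE:
  assumes "minimal_ve_dominating_set G D" "x \<in> D"
  obtains e where "e \<in> parcs G" "D \<inter> edge_hood G e = {x}"
proof -
  have "\<not> ve_dominating_set G (D - {x})" "ve_dominating_set G D"
    using assms by (auto simp: minimal_ve_dominating_set_def)
  then obtain e where "e \<in> parcs G" "(D - {x}) \<inter> edge_hood G e = {}" "D \<inter> edge_hood G e \<noteq> {}"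
    unfolding ve_dominating_set_iff by blast
  then show ?thesis using that[of e] by blast
qed

text \<open>
  How a prescribed vertex is put into a minimal set: it is forced into the set by
  excluding, through \<open>B\<close>, the remaining vertices of some hood that contains it.
\<close>

lemma minimal_ve_dominating_set_avoiding:
  assumes "\<And>e. e \<in> parcs G \<Longrightarrow> \<not> edge_hood G e \<subseteq> B"
  obtains D where "minimal_ve_dominating_set G D" "D \<inter> B = {}"
proof -
  have "ve_dominating_set G (pverts G - B)"
    unfolding ve_dominating_set_iff using assms edge_hood_subset by blast
  then obtain D where "D \<subseteq> pverts G - B" "minimal_ve_dominating_set G D"
    by (rule minimal_ve_dominating_subset)
  then show ?thesis by (intro that) blast+
qed

lemma minimal_ve_dominating_set_meets:
  "minimal_ve_dominating_set G D \<Longrightarrow> e \<in> parcs G \<Longrightarrow> D \<inter> edge_hood G e \<noteq> {}"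
  by (auto simp: minimal_ve_dominating_set_def ve_dominating_set_iff)

text \<open>
  A minimal set needs a vertex in each of the disjoint hoods.  As all minimal sets have the size of
  one contained in \<open>D\<^sub>0\<close>, there is no room for any further vertex.
\<close>

lemma minimal_sets_are_packing_representatives:
  assumes well: "well_ve_dominated G"
    and P: "P \<subseteq> parcs G" "disjoint_family_on (edge_hood G) P"
    and D\<^sub>0: "ve_dominating_set G D\<^sub>0" "card D\<^sub>0 \<le> card P"
    and D: "minimal_ve_dominating_set G D"
  shows "D \<subseteq> (\<Union>e\<in>P. edge_hood G e)"
    and "\<And>e x y. e \<in> P \<Longrightarrow> x \<in> D \<Longrightarrow> y \<in> D \<Longrightarrow> x \<in> edge_hood G e \<Longrightarrow> y \<in> edge_hood G e \<Longrightarrow> x = y"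
proof -
  have "D\<^sub>0 \<subseteq> pverts G" "D \<subseteq> pverts G"
    using D\<^sub>0 D by (simp_all add: ve_dominating_set_def minimal_ve_dominating_set_def)
  then have fin: "finite D\<^sub>0" "finite D" "finite P"
    using pair_finite_verts pair_finite_arcs P(1) finite_subset by blast+
  obtain D\<^sub>1 where "D\<^sub>1 \<subseteq> D\<^sub>0" "minimal_ve_dominating_set G D\<^sub>1"
    using D\<^sub>0(1) by (rule minimal_ve_dominating_subset)
  then have "card D = card D\<^sub>1" "card D\<^sub>1 \<le> card D\<^sub>0"
    using well D card_mono[OF fin(1)] unfolding well_ve_dominated_def by blast+
  then have "card D \<le> card P" using D\<^sub>0(2) by simp
  define g where "g e = (SOME x. x \<in> D \<inter> edge_hood G e)" for e
  have g: "g e \<in> D" "g e \<in> edge_hood G e" if "e \<in> P" for e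
  proof -
    have "D \<inter> edge_hood G e \<noteq> {}"
      using minimal_ve_dominating_set_meets[OF D] P(1) that by blast
    then have "g e \<in> D \<inter> edge_hood G e"
      unfolding g_def by (rule some_in_eq[THEN iffD2])
    then show "g e \<in> D" "g e \<in> edge_hood G e" by blast+
  qed
  have eq: "e = f" if "e \<in> P" "f \<in> P" "x \<in> edge_hood G e" "x \<in> edge_hood G f" for e f x
    using P(2) that by (auto simp: disjoint_family_on_def)
  have "inj_on g P"
  proof (rule inj_onI)
    fix e f assume "e \<in> P" "f \<in> P" "g e = g f"
    then show "e = f" using eq[of e f "g e"] g(2)[of e] g(2)[of f] by simp
  qed
  then have "card (g ` P) = card P" by (rule card_image)
  moreover have "g ` P \<subseteq> D" using g(1) by blast
  ultimately have gP: "g ` P = D"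
    using \<open>card D \<le> card P\<close> fin(2) by (intro card_seteq) simp_all
  then show "D \<subseteq> (\<Union>e\<in>P. edge_hood G e)" using g(2) by blast
  fix e x y
  assume *: "e \<in> P" "x \<in> D" "y \<in> D" "x \<in> edge_hood G e" "y \<in> edge_hood G e"
  then obtain a b where ab: "a \<in> P" "b \<in> P" "x = g a" "y = g b" using gP by blast
  then have "a = e" "b = e" using * eq[of a e x] eq[of b e y] g(2) by simp_all
  then show "x = y" using ab by simp
qed

end

section \<open>As many disjoint hoods as dominating vertices\<close>

context simple_tree begin

text \<open>
  In a rooted tree every hood has a top vertex, reached from each of its members by going to parents
  without leaving the hood.  A hood that meets one with a top at least as deep contains
  that top.  So choosing an edge whose hood has the deepest top, and discarding all edges whose hoods
  contain this top, leaves only hoods disjoint from the chosen one.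
\<close>

lemma hood_packing:
  obtains P D where "P \<subseteq> parcs T" "disjoint_family_on (edge_hood T) P"
    "ve_dominating_set T D" "card D \<le> card P"
proof -
  obtain d parent where d: "\<And>u v. (u, v) \<in> parcs T \<Longrightarrow>
       d v < d u \<and> v = parent u \<or> (d u :: nat) < d v \<and> u = parent v"
    using depth_function by blast
  define is_top where
    "is_top e t \<longleftrightarrow> t \<in> edge_hood T e \<and>
       (\<forall>z \<in> edge_hood T e. z = t \<or> parent z \<in> edge_hood T e \<and> d (parent z) < d z \<and> d t < d z)"
    for e t
  have ex_top: "\<exists>t. is_top e t" if e: "e \<in> parcs T" for e
  proof -
    obtain u v where uv: "(u, v) \<in> parcs T" "d v < d u" "v = parent u" "edge_hood T e = cnbhd u \<union> cnbhd v"
      using d[of "fst e" "snd e"] e arcs_symmetric[of "fst e" "snd e"]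
      by (metis edge_hood_def prod.collapse sup_commute)
    \<comment> \<open>The values of \<open>parent\<close> mean nothing at the root, which is recognised by having no neighbour of smaller depth.\<close>
    define t where "t = (if (v, parent v) \<in> parcs T \<and> d (parent v) < d v then parent v else v)"
    have t: "d t \<le> d v" "t = v \<or> parent v = t" "t = v \<or> d t < d v" "t \<in> cnbhd v"
      by (auto simp: t_def closed_neighborhood_def open_neighborhood_def)
    have v: "v \<in> cnbhd v" "u \<in> cnbhd u"
      by (simp_all add: closed_neighborhood_def)
    have pu: "parent u = v" using uv(3) by simp
    have zv: "v = t \<or> parent v \<in> cnbhd u \<union> cnbhd v \<and> d (parent v) < d v \<and> d t < d v"
      using t by auto
    have "is_top e t"
      unfolding is_top_def uv(4)
    proof (intro conjI ballI)
      show "t \<in> cnbhd u \<union> cnbhd v" using t by blast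
      fix z assume "z \<in> cnbhd u \<union> cnbhd v"
      then consider "z = u" | "z = v" | "(u, z) \<in> parcs T" | "(v, z) \<in> parcs T"
        by (auto simp: closed_neighborhood_def open_neighborhood_def)
      then show "z = t \<or> parent z \<in> cnbhd u \<union> cnbhd v \<and> d (parent z) < d z \<and> d t < d z"
      proof cases
        case 1
        then show ?thesis using uv(2) pu v t(1) by simp
      next
        case 2
        then show ?thesis using zv by simp
      next
        case 3
        from d[OF 3] show ?thesis
        proof (elim disjE conjE)
          assume "z = parent u" then show ?thesis using pu zv by simp
        next
          assume "d u < d z" "u = parent z" then show ?thesis using uv(2) t(1) v(2) by simp
        qed
      next
        case 4
        from d[OF 4] show ?thesis
        proof (elim disjE conjE)
          assume "d z < d v" "z = parent v" then show ?thesis using 4 by (simp add: t_def)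
        next
          assume "d v < d z" "v = parent z" then show ?thesis using t(1) v(1) by simp
        qed
      qed
    qed
    then show ?thesis ..
  qed
  define top where "top e = (SOME t. is_top e t)" for e
  have top: "is_top e (top e)" if "e \<in> parcs T" for e
    unfolding top_def using ex_top[OF that] by (rule someI_ex)
  have top_in: "top e \<in> edge_hood T e" if "e \<in> parcs T" for e
    using top[OF that] by (simp add: is_top_def)
  \<comment> \<open>Climb from a common vertex: the top of \<open>e\<close> is reached no later than that of \<open>f\<close>,
    hence within the hood of \<open>f\<close>.\<close>
  have meet: "top e \<in> edge_hood T f"
    if e: "e \<in> parcs T" and f: "f \<in> parcs T" and "d (top f) \<le> d (top e)"
      and "z \<in> edge_hood T e" "z \<in> edge_hood T f" for e f z
    using that(4,5)
  proof (induction "d z" arbitrary: z rule: less_induct)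
    case less
    show ?case
    proof (cases "z = top e")
      case True
      then show ?thesis using less.prems by simp
    next
      case False
      then have e_up: "parent z \<in> edge_hood T e" "d (parent z) < d z" "d (top e) < d z"
        using top[OF e] less.prems(1) by (auto simp: is_top_def)
      then have "z \<noteq> top f" using that(3) by auto
      then have "parent z \<in> edge_hood T f"
        using top[OF f] less.prems(2) by (auto simp: is_top_def)
      then show ?thesis using less.hyps e_up by blast
    qed
  qed
  have main: "\<exists>P D. P \<subseteq> A \<and> D \<subseteq> pverts T \<and> disjoint_family_on (edge_hood T) P \<and>
      (\<forall>e \<in> A. D \<inter> edge_hood T e \<noteq> {}) \<and> finite D \<and> card D \<le> card P"
    if "A \<subseteq> parcs T" for A
    using finite_subset[OF that pair_finite_arcs] that
  proof (induction A rule: finite_psubset_induct)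
    case (psubset A)
    show ?case
    proof (cases "A = {}")
      case True
      then show ?thesis by (intro exI[of _ "{}"]) (auto simp: disjoint_family_on_def)
    next
      case False
      let ?M = "Max ((d \<circ> top) ` A)"
      have "?M \<in> (d \<circ> top) ` A" using False psubset.hyps by (intro Max_in) auto
      then obtain e where e: "e \<in> A" "d (top e) = ?M" by auto
      have deepest: "d (top f) \<le> d (top e)" if "f \<in> A" for f
        unfolding e(2) using that psubset.hyps by (intro Max_ge) auto
      let ?A = "{f \<in> A. top e \<notin> edge_hood T f}"
      have eT: "e \<in> parcs T" using e psubset.prems by blast
      have sub: "?A \<subseteq> parcs T" using psubset.prems by blast
      have "?A \<subset> A" using e top_in[OF eT] by blast
      then obtain P D where PD: "P \<subseteq> ?A" "D \<subseteq> pverts T" "disjoint_family_on (edge_hood T) P"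
        "\<forall>f \<in> ?A. D \<inter> edge_hood T f \<noteq> {}" "finite D" "card D \<le> card P"
        using psubset.IH[OF \<open>?A \<subset> A\<close> sub] by blast
      have disj: "edge_hood T e \<inter> edge_hood T f = {}" if "f \<in> ?A" for f
        using meet[OF eT, of f] that deepest psubset.prems by blast
      have eP: "e \<notin> P" using PD(1) top_in[OF eT] by blast
      have dP: "\<forall>f\<in>P. edge_hood T e \<inter> edge_hood T f = {}"
        using PD(1) disj by (meson subsetD)
      have "disjoint_family_on (edge_hood T) (insert e P)"
        using PD(3) dP eP by (simp add: disjoint_family_on_insert Int_UN_distrib)
      moreover have "finite P"
        using PD(1) psubset.hyps by (blast intro: finite_subset)
      then have "card (insert (top e) D) \<le> card (insert e P)"
        using eP PD(5,6) by (simp add: card_insert_if)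
      moreover have "insert (top e) D \<subseteq> pverts T"
        using PD(2) top_in[OF eT] edge_hood_subset[OF eT] by blast
      moreover have "\<forall>f\<in>A. insert (top e) D \<inter> edge_hood T f \<noteq> {}"
        using PD(4) by blast
      moreover have "insert e P \<subseteq> A" using PD(1) e by blast
      ultimately show ?thesis using PD(5)
        by (intro exI[of _ "insert e P"] exI[of _ "insert (top e) D"] conjI) (assumption | simp)+
    qed
  qed
  show ?thesis
    using main[OF subset_refl] by (elim exE conjE) (rule that, simp_all add: ve_dominating_set_iff)
qed

end

section \<open>Vertices that share a minimal ve-dominating set\<close>

context simple_tree begin

lemma in_nbhd_iff [simp]: "v \<in> nbhd u \<longleftrightarrow> (u, v) \<in> parcs T"
  by (simp add: open_neighborhood_def)

lemma in_cnbhd_iff [simp]: "v \<in> cnbhd u \<longleftrightarrow> v = u \<or> (u, v) \<in> parcs T"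
  by (simp add: closed_neighborhood_def)

lemma in_edge_hood_iff [simp]: "z \<in> edge_hood T (u, v) \<longleftrightarrow> z \<in> cnbhd u \<or> z \<in> cnbhd v"
  by (simp add: edge_hood_def)

lemma arc_sym: "(u, v) \<in> parcs T \<longleftrightarrow> (v, u) \<in> parcs T"
  using arcs_symmetric by blast

lemma no_triangle: "(a, b) \<in> parcs T \<Longrightarrow> (b, c) \<in> parcs T \<Longrightarrow> (a, c) \<notin> parcs T"
  using nonbacktracking_ends_not_adjacent[of "[a, b, c]"] arc_neq[of a c] by auto

lemma nonbacktracking_ends_apart:
  assumes "nonbacktracking (parcs T) ws" "3 \<le> length ws"
  shows "last ws \<notin> cnbhd (hd ws)" "hd ws \<notin> cnbhd (last ws)"
  using nonbacktracking_hd_neq_last[OF assms(1)] nonbacktracking_ends_not_adjacent[OF assms]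
    assms(2) arc_sym by auto

text \<open>
  An edge whose hood lies in the hood of $zs$ but misses \<open>z\<close> would have both ends among the neighbours
  of \<open>s\<close>, forming a triangle.  So all vertices of the hood of $zs$ other than \<open>z\<close> may be excluded.
\<close>

lemma vertex_in_minimal_set:
  assumes zs: "(z, s) \<in> parcs T"
  obtains D where "minimal_ve_dominating_set T D" "z \<in> D"
proof -
  let ?B = "edge_hood T (z, s) - {z}"
  have "\<not> edge_hood T e \<subseteq> ?B" if e: "e \<in> parcs T" for e
  proof
    assume sub: "edge_hood T e \<subseteq> ?B"
    obtain p q where pq: "e = (p, q)" by fastforce
    have "p \<notin> cnbhd z" "q \<notin> cnbhd z"
      using sub arc_sym by (auto simp: pq)
    moreover have "p \<in> ?B" "q \<in> ?B"
      using sub by (auto simp: pq)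
    ultimately have "(s, p) \<in> parcs T" "(s, q) \<in> parcs T"
      using zs by auto
    then show False using no_triangle[of p q s] e pq arc_sym by blast
  qed
  then obtain D where D: "minimal_ve_dominating_set T D" "D \<inter> ?B = {}"
    by (rule minimal_ve_dominating_set_avoiding)
  then have "z \<in> D"
    using minimal_ve_dominating_set_meets[OF D(1) zs] by blast
  then show ?thesis using that D by blast
qed

text \<open>
  The edges $xx'$ and $yy'$ become private to \<open>x\<close> and \<open>y\<close> by excluding all other vertices of their
  hoods.  This is possible unless the excluded vertices contain a whole hood; the edge of such a hood
  would have no end near \<open>x\<close> or \<open>y\<close>, hence one end next to $x'$ and the other next to $y'$, since two
  ends next to the same vertex would form a triangle with it.
\<close>

lemma two_vertices_in_minimal_set:
  assumes xx: "(x, x') \<in> parcs T" and yy: "(y, y') \<in> parcs T"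
    and y: "y \<notin> cnbhd x" "y \<notin> cnbhd x'" and x: "x \<notin> cnbhd y'"
    and sep: "\<And>p q. (x', p) \<in> parcs T \<Longrightarrow> (y', q) \<in> parcs T \<Longrightarrow>
        p \<notin> cnbhd x \<union> cnbhd y \<Longrightarrow> q \<notin> cnbhd x \<union> cnbhd y \<Longrightarrow> (p, q) \<notin> parcs T"
  obtains D where "minimal_ve_dominating_set T D" "x \<in> D" "y \<in> D"
proof -
  let ?B = "(edge_hood T (x, x') \<union> edge_hood T (y, y')) - {x, y}"
  have "\<not> edge_hood T e \<subseteq> ?B" if e: "e \<in> parcs T" for e
  proof
    assume sub: "edge_hood T e \<subseteq> ?B"
    obtain p q where pq: "e = (p, q)" by fastforce
    have far: "p \<notin> cnbhd x \<union> cnbhd y" "q \<notin> cnbhd x \<union> cnbhd y"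
      using sub arc_sym by (auto simp: pq)
    moreover have "p \<in> ?B" "q \<in> ?B"
      using sub by (auto simp: pq)
    ultimately have "(x', p) \<in> parcs T \<or> (y', p) \<in> parcs T" "(x', q) \<in> parcs T \<or> (y', q) \<in> parcs T"
      using xx yy by auto
    moreover have "\<not> ((s, p) \<in> parcs T \<and> (s, q) \<in> parcs T)" for s
      using no_triangle[of p q s] e pq arc_sym by blast
    ultimately show False
      using sep[of p q] sep[of q p] far e pq arc_sym by blast
  qed
  then obtain D where D: "minimal_ve_dominating_set T D" "D \<inter> ?B = {}"
    by (rule minimal_ve_dominating_set_avoiding)
  have "x \<notin> cnbhd y" using y(1) arc_sym by auto
  then have "y \<notin> edge_hood T (x, x')" "x \<notin> edge_hood T (y, y')"
    using x y by (simp_all add: edge_hood_def)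
  then have "x \<in> D" "y \<in> D"
    using minimal_ve_dominating_set_meets[OF D(1) xx] minimal_ve_dominating_set_meets[OF D(1) yy]
      D(2) by blast+
  then show ?thesis using that D by blast
qed

text \<open>
  The private edges are $au$ and $bv$: an offending edge $pq$ would close the walk \<open>p, u, v, q\<close>.
\<close>

lemma opposite_neighbours_in_minimal_set:
  assumes uv: "(u, v) \<in> parcs T"
    and a: "(u, a) \<in> parcs T" "a \<noteq> v" and b: "(v, b) \<in> parcs T" "b \<noteq> u"
  obtains D where "minimal_ve_dominating_set T D" "a \<in> D" "b \<in> D"
proof (rule two_vertices_in_minimal_set[of a u b v])
  note [simp] = arc_sym[THEN iffD1, OF a(1)] uv b a b(2)[symmetric] a(2)[symmetric]
  show "b \<notin> cnbhd a" using nonbacktracking_ends_apart[of "[a, u, v, b]"] by simp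
  show "b \<notin> cnbhd u" using nonbacktracking_ends_apart[of "[u, v, b]"] by simp
  show "a \<notin> cnbhd v" using nonbacktracking_ends_apart[of "[a, u, v]"] by simp
  fix p q
  assume *: "(u, p) \<in> parcs T" "(v, q) \<in> parcs T" "p \<notin> cnbhd a \<union> cnbhd b" "q \<notin> cnbhd a \<union> cnbhd b"
  moreover have "(b, v) \<in> parcs T" "(p, u) \<in> parcs T" using * b arc_sym by blast+
  ultimately have "p \<noteq> v" "q \<noteq> u" "(p, u) \<in> parcs T" by auto
  then show "(p, q) \<notin> parcs T"
    using nonbacktracking_ends_apart[of "[p, u, v, q]"] *(2) by simp
qed (use assms arc_sym in auto)

text \<open>
  For \<open>a\<close> and \<open>b\<close> adjacent to the same vertex \<open>c\<close>, the edge $ac$ would be dominated by \<open>b\<close>, so the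
  private edges must point away from \<open>c\<close>.  This is why \<open>a\<close> and \<open>b\<close> must not be leaves.
  An offending edge $pq$ would close the walk \<open>p, a', a, c, b, b', q\<close>.
\<close>

lemma nonleaf_siblings_in_minimal_set:
  assumes c: "(c, a) \<in> parcs T" "(c, b) \<in> parcs T" "a \<noteq> b"
    and a': "(a, a') \<in> parcs T" "a' \<noteq> c" and b': "(b, b') \<in> parcs T" "b' \<noteq> c"
  obtains D where "minimal_ve_dominating_set T D" "a \<in> D" "b \<in> D"
proof (rule two_vertices_in_minimal_set[OF a'(1) b'(1)])
  have [simp]: "(a, c) \<in> parcs T" "(a', a) \<in> parcs T"
    using c a' arc_sym by blast+
  note [simp] = c b' a' c(3)[symmetric] b'(2)[symmetric] a'(2)[symmetric]
  show "b \<notin> cnbhd a" using nonbacktracking_ends_apart[of "[a, c, b]"] by simp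
  show "b \<notin> cnbhd a'" using nonbacktracking_ends_apart[of "[a', a, c, b]"] by simp
  show "a \<notin> cnbhd b'" using nonbacktracking_ends_apart[of "[a, c, b, b']"] by simp
  fix p q
  assume *: "(a', p) \<in> parcs T" "(b', q) \<in> parcs T" "p \<notin> cnbhd a \<union> cnbhd b" "q \<notin> cnbhd a \<union> cnbhd b"
  then have "p \<noteq> a" "q \<noteq> b" "(p, a') \<in> parcs T" using arc_sym by auto
  then show "(p, q) \<notin> parcs T"
    using nonbacktracking_ends_apart[of "[p, a', a, c, b, b', q]"] *(2) by simp
qed

lemma ex_other_neighbour:
  "(u, v) \<in> parcs T \<Longrightarrow> nbhd u \<noteq> {v} \<Longrightarrow> \<exists>w. (u, w) \<in> parcs T \<and> w \<noteq> v"
  by (auto simp: open_neighborhood_def)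

text \<open>
  If no minimal set has two vertices in the hood of $uv$, then only one end of $uv$ can have a further
  neighbour, so $uv$ is pendant; and its support \<open>c\<close> has at most one neighbour that is not a leaf.
  Two leaves at \<open>c\<close> would be false twins, so there is just the leaf \<open>l\<close>.
\<close>

lemma pendant_edge_if_one_representative:
  assumes reduced: "reduced T" and uv: "(u, v) \<in> parcs T"
    and one: "\<And>D x y. minimal_ve_dominating_set T D \<Longrightarrow> x \<in> D \<Longrightarrow> y \<in> D \<Longrightarrow>
        x \<in> edge_hood T (u, v) \<Longrightarrow> y \<in> edge_hood T (u, v) \<Longrightarrow> x = y"
  obtains c l where "{u, v} = {c, l}" "nbhd l = {c}" "nbhd c = {l}"
  | c l w where "{u, v} = {c, l}" "nbhd l = {c}" "nbhd c = {l, w}" "w \<noteq> l"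
proof -
  have vu: "(v, u) \<in> parcs T" using uv arc_sym by blast
  have not_both: "\<not> (a \<in> edge_hood T (u, v) \<and> b \<in> edge_hood T (u, v) \<and> a \<noteq> b)"
    if "minimal_ve_dominating_set T D" "a \<in> D" "b \<in> D" for D a b
    using one that by blast
  have "nbhd u = {v} \<or> nbhd v = {u}"
  proof (rule ccontr)
    assume "\<not> (nbhd u = {v} \<or> nbhd v = {u})"
    then obtain a b where a: "(u, a) \<in> parcs T" "a \<noteq> v" and b: "(v, b) \<in> parcs T" "b \<noteq> u"
      using ex_other_neighbour[OF uv] ex_other_neighbour[OF vu] by blast
    have ab: "a \<noteq> b" "a \<in> edge_hood T (u, v)" "b \<in> edge_hood T (u, v)"
      using no_triangle[OF uv b(1)] a b by auto
    obtain D where "minimal_ve_dominating_set T D" "a \<in> D" "b \<in> D"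
      using uv a b by (rule opposite_neighbours_in_minimal_set)
    then show False using not_both ab by blast
  qed
  then obtain c l where cl: "{u, v} = {c, l}" "nbhd l = {c}" "edge_hood T (u, v) = cnbhd c \<union> cnbhd l"
    by (auto simp: edge_hood_def)
  have "c \<in> nbhd l" using cl(2) by blast
  then have lc: "(l, c) \<in> parcs T" "(c, l) \<in> parcs T" using arc_sym by simp_all
  have leaf_unique: "a = l" if "nbhd a = {c}" for a
  proof -
    have "c \<in> nbhd a" using that by blast
    then have "a \<in> pverts T" "l \<in> pverts T" using lc wellformed' by simp_all
    then show ?thesis
      using reduced that cl(2) unfolding reduced_def false_twins_def by metis
  qed
  have single: "a = b" if a: "(c, a) \<in> parcs T" "a \<noteq> l" and b: "(c, b) \<in> parcs T" "b \<noteq> l" for a b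
  proof (rule ccontr)
    assume "a \<noteq> b"
    obtain a' b' where a'b': "(a, a') \<in> parcs T" "a' \<noteq> c" "(b, b') \<in> parcs T" "b' \<noteq> c"
      using leaf_unique[of a] leaf_unique[of b] a b arc_sym
        ex_other_neighbour[of a c] ex_other_neighbour[of b c] by blast
    obtain D where "minimal_ve_dominating_set T D" "a \<in> D" "b \<in> D"
      using a(1) b(1) \<open>a \<noteq> b\<close> a'b' by (rule nonleaf_siblings_in_minimal_set)
    moreover have "a \<in> edge_hood T (u, v)" "b \<in> edge_hood T (u, v)"
      using cl(3) a b by auto
    ultimately show False using not_both \<open>a \<noteq> b\<close> by blast
  qed
  show ?thesis
  proof (cases "nbhd c = {l}")
    case True
    then show ?thesis using that(1) cl by blast
  next
    case False
    then obtain w where w: "(c, w) \<in> parcs T" "w \<noteq> l" using lc ex_other_neighbour by blast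
    then have "nbhd c = {l, w}" using single lc by (auto simp: open_neighborhood_def)
    then show ?thesis using that(2) cl w by blast
  qed
qed

end

section \<open>Pendant blocks\<close>

text \<open>
  An attachment of pendant paths seen from inside the graph: the vertices fall into the disjoint blocks
  \<open>{b i, c i, l i}\<close>, where \<open>b i\<close> is a vertex of the original graph and \<open>c i\<close>, \<open>l i\<close> form the path
  attached to it.  An arbitrary index set lets the blocks be indexed by edges of a packing
  as well as by vertices of the original graph.
\<close>

definition pendant_blocks ::
    "'a pair_pre_digraph \<Rightarrow> 'i set \<Rightarrow> ('i \<Rightarrow> 'a) \<Rightarrow> ('i \<Rightarrow> 'a) \<Rightarrow> ('i \<Rightarrow> 'a) \<Rightarrow> bool" where
  "pendant_blocks G I b c l \<longleftrightarrow>
     pverts G = (\<Union>i\<in>I. {b i, c i, l i}) \<and>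
     disjoint_family_on (\<lambda>i. {b i, c i, l i}) I \<and>
     (\<forall>i\<in>I. b i \<noteq> l i \<and> open_neighborhood G (l i) = {c i} \<and>
        open_neighborhood G (c i) = {l i, b i})"

lemma pendant_blocksD:
  assumes "pendant_blocks G I b c l"
  shows "pverts G = (\<Union>i\<in>I. {b i, c i, l i})"
    and "i \<in> I \<Longrightarrow> j \<in> I \<Longrightarrow> z \<in> {b i, c i, l i} \<Longrightarrow> z \<in> {b j, c j, l j} \<Longrightarrow> i = j"
    and "i \<in> I \<Longrightarrow> b i \<noteq> l i"
    and "i \<in> I \<Longrightarrow> (l i, z) \<in> parcs G \<longleftrightarrow> z = c i"
    and "i \<in> I \<Longrightarrow> (c i, z) \<in> parcs G \<longleftrightarrow> z = l i \<or> z = b i"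
  using assms unfolding pendant_blocks_def open_neighborhood_def disjoint_family_on_def by blast+

text \<open>
  Along each pendant path the sets of dominated edges grow towards the original graph.
\<close>

lemma (in pair_pseudo_graph) pendant_blocks_nested:
  assumes pb: "pendant_blocks G I b c l" and i: "i \<in> I" and e: "e \<in> parcs G"
  shows "l i \<in> edge_hood G e \<Longrightarrow> c i \<in> edge_hood G e"
    and "c i \<in> edge_hood G e \<Longrightarrow> b i \<in> edge_hood G e"
proof -
  note arcs = pendant_blocksD(4,5)[OF pb i]
  have arcs': "(z, l i) \<in> parcs G \<longleftrightarrow> z = c i" "(z, c i) \<in> parcs G \<longleftrightarrow> z = l i \<or> z = b i" for z
    using arcs arcs_symmetric by blast+
  obtain p q where pq: "e = (p, q)" by fastforce
  have mem: "z \<in> edge_hood G e \<longleftrightarrow> z = p \<or> z = q \<or> (z, p) \<in> parcs G \<or> (z, q) \<in> parcs G" for z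
    using arcs_symmetric
    by (auto simp: pq edge_hood_def closed_neighborhood_def open_neighborhood_def)
  have e': "(p, q) \<in> parcs G" "(q, p) \<in> parcs G" using e pq arcs_symmetric by auto
  show "l i \<in> edge_hood G e \<Longrightarrow> c i \<in> edge_hood G e"
    unfolding mem using arcs e' by auto
  show "c i \<in> edge_hood G e \<Longrightarrow> b i \<in> edge_hood G e"
    unfolding mem using arcs arcs' e' by auto
qed

text \<open>
  By nestedness, of two vertices in one block one dominates every edge that the other does, which
  therefore has no private edge.  The block itself is the hood of the pendant edge and so must be met.
\<close>

lemma (in pair_pseudo_graph) card_minimal_set_pendant_blocks:
  assumes pb: "pendant_blocks G I b c l" and D: "minimal_ve_dominating_set G D"
  shows "card D = card I"
proof -
  let ?B = "\<lambda>i. {b i, c i, l i}"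
  note arcs = pendant_blocksD(4,5)[OF pb]
  have not_below: "\<not> (\<forall>e \<in> parcs G. x \<in> edge_hood G e \<longrightarrow> y \<in> edge_hood G e)"
    if xy: "x \<in> D" "y \<in> D" "x \<noteq> y" for x y
  proof
    assume *: "\<forall>e \<in> parcs G. x \<in> edge_hood G e \<longrightarrow> y \<in> edge_hood G e"
    obtain e where e: "e \<in> parcs G" "D \<inter> edge_hood G e = {x}"
      using D xy(1) by (rule minimal_ve_dominating_setE)
    have "x \<in> edge_hood G e" using e(2) by blast
    then have "y \<in> D \<inter> edge_hood G e" using * e(1) xy(2) by simp
    then show False using e(2) xy(3) by simp
  qed
  have unique: "x = y" if i: "i \<in> I" and x: "x \<in> D" "x \<in> ?B i" and y: "y \<in> D" "y \<in> ?B i" for i x y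
  proof (rule ccontr)
    assume "x \<noteq> y"
    have "(\<forall>e \<in> parcs G. x \<in> edge_hood G e \<longrightarrow> y \<in> edge_hood G e) \<or>
      (\<forall>e \<in> parcs G. y \<in> edge_hood G e \<longrightarrow> x \<in> edge_hood G e)"
      using pendant_blocks_nested[OF pb i] x(2) y(2) by blast
    then show False using not_below x(1) y(1) \<open>x \<noteq> y\<close> by blast
  qed
  have meets: "\<exists>x. x \<in> D \<and> x \<in> ?B i" if i: "i \<in> I" for i
  proof -
    have "(c i, l i) \<in> parcs G" using arcs[OF i] by simp
    then have "D \<inter> edge_hood G (c i, l i) \<noteq> {}"
      by (rule minimal_ve_dominating_set_meets[OF D])
    moreover have "edge_hood G (c i, l i) = ?B i"
      using arcs[OF i]
      by (auto simp: edge_hood_def closed_neighborhood_def open_neighborhood_def)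
    ultimately show ?thesis by auto
  qed
  define pick where "pick i = (SOME x. x \<in> D \<and> x \<in> ?B i)" for i
  have pick: "pick i \<in> D" "pick i \<in> ?B i" if "i \<in> I" for i
    using someI_ex[OF meets[OF that]] by (simp_all only: pick_def)
  have "bij_betw pick I D"
  proof (rule bij_betw_imageI)
    show "inj_on pick I"
    proof (rule inj_onI)
      fix i j assume "i \<in> I" "j \<in> I" "pick i = pick j"
      then show "i = j"
        using pendant_blocksD(2)[OF pb, of i j "pick i"] pick(2)[of i] pick(2)[of j] by simp
    qed
    have "x \<in> pick ` I" if x: "x \<in> D" for x
    proof -
      have "x \<in> pverts G"
        using D x by (auto simp: minimal_ve_dominating_set_def ve_dominating_set_def)
      then obtain i where i: "i \<in> I" "x \<in> ?B i"
        unfolding pendant_blocksD(1)[OF pb] by blast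
      then have "x = pick i" using unique x pick by blast
      then show ?thesis using i by blast
    qed
    then show "pick ` I = D" using pick(1) by blast
  qed
  then show ?thesis by (rule bij_betw_same_card[symmetric])
qed

text \<open>
  Here every edge is dominated by every vertex, so the minimal sets are singletons,
  or empty if there is no edge.
\<close>

lemma (in pair_graph) well_ve_dominated_if_card_le_2:
  assumes "card (pverts G) \<le> 2"
  shows "well_ve_dominated G"
proof -
  have hood: "edge_hood G e = pverts G" if e: "e \<in> parcs G" for e
  proof (rule card_seteq[OF pair_finite_verts edge_hood_subset[OF e]])
    have "{fst e, snd e} \<subseteq> edge_hood G e"
      by (simp add: edge_hood_def closed_neighborhood_def)
    moreover have "finite (edge_hood G e)"
      using edge_hood_subset[OF e] pair_finite_verts by (rule finite_subset)
    ultimately have "card {fst e, snd e} \<le> card (edge_hood G e)"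
      by (rule card_mono[rotated])
    then show "card (pverts G) \<le> card (edge_hood G e)"
      using assms pair_no_loops[OF e] by simp
  qed
  have "card D = (if parcs G = {} then 0 else 1)" if D: "minimal_ve_dominating_set G D" for D
  proof (cases "parcs G = {}")
    case True
    then have "D = {}"
      using minimal_ve_dominating_setE[OF D] by blast
    then show ?thesis using True by simp
  next
    case False
    then obtain x where x: "x \<in> D"
      using minimal_ve_dominating_set_meets[OF D] by blast
    have "y = x" if y: "y \<in> D" for y
    proof -
      have "D \<subseteq> pverts G"
        using D by (simp add: minimal_ve_dominating_set_def ve_dominating_set_def)
      then show ?thesis
        using minimal_ve_dominating_setE[OF D y] hood x by blast
    qed
    then have "D = {x}" using x by blast
    then show ?thesis using False by simp
  qed
  then show ?thesis unfolding well_ve_dominated_def by simp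
qed

section \<open>Isomorphism with an attachment of pendant paths\<close>

lemma digraph_iso_with_proj_iff:
  assumes "pair_wf_digraph G"
  shows "digraph_iso (with_proj G) (with_proj H) \<longleftrightarrow>
    (\<exists>f. inj_on f (pverts G) \<and> pverts H = f ` pverts G \<and> parcs H = map_prod f f ` parcs G)"
proof
  assume "digraph_iso (with_proj G) (with_proj H)"
  then obtain h where h: "pre_digraph.digraph_isomorphism (with_proj G) h"
    and H: "with_proj H = app_iso h (with_proj G)"
    unfolding digraph_iso_def by blast
  let ?f = "iso_verts h"
  have tail: "iso_tail h = fst" and head: "iso_head h = snd"
    using arg_cong[OF H, of tail] arg_cong[OF H, of head] by simp_all
  have "iso_arcs h e = map_prod ?f ?f e" if "e \<in> parcs G" for e
    using h that tail head
    by (auto simp: pre_digraph.digraph_isomorphism_def prod_eq_iff)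
  then have "parcs H = map_prod ?f ?f ` parcs G"
    using arg_cong[OF H, of arcs] by (simp cong: image_cong)
  moreover have "pverts H = ?f ` pverts G"
    using arg_cong[OF H, of verts] by simp
  moreover have "inj_on ?f (pverts G)"
    using h by (simp add: pre_digraph.digraph_isomorphism_def)
  ultimately show "\<exists>f. inj_on f (pverts G) \<and> pverts H = f ` pverts G \<and>
      parcs H = map_prod f f ` parcs G" by blast
next
  interpret G: pair_wf_digraph G by fact
  assume "\<exists>f. inj_on f (pverts G) \<and> pverts H = f ` pverts G \<and> parcs H = map_prod f f ` parcs G"
  then obtain f where f: "inj_on f (pverts G)" "pverts H = f ` pverts G"
    "parcs H = map_prod f f ` parcs G" by blast
  let ?h = "\<lparr> iso_verts = f, iso_arcs = map_prod f f, iso_head = snd, iso_tail = fst \<rparr>"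
  have "inj_on (map_prod f f) (parcs G)"
    by (rule inj_on_subset[OF map_prod_inj_on[OF f(1) f(1)]]) (auto dest: G.wellformed')
  then have "pre_digraph.digraph_isomorphism (with_proj G) ?h"
    using f(1) assms by (auto simp: pre_digraph.digraph_isomorphism_def wf_digraph_wp_iff)
  moreover have "with_proj H = app_iso ?h (with_proj G)"
    using f by (simp add: app_iso_def with_proj_def)
  ultimately show "digraph_iso (with_proj G) (with_proj H)"
    unfolding digraph_iso_def by blast
qed

lemma card_eq_if_digraph_iso:
  "pair_wf_digraph G \<Longrightarrow> digraph_iso (with_proj G) (with_proj H) \<Longrightarrow> card (pverts H) = card (pverts G)"
  by (auto simp: digraph_iso_with_proj_iff card_image)

lemma pendant_blocks_attach:
  assumes "pair_wf_digraph H"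
  shows "pendant_blocks (attach_pendant_P2 H) (pverts H) Base Mid Leaf"
  unfolding pendant_blocks_def attach_pendant_P2_def open_neighborhood_def disjoint_family_on_def
  using pair_wf_digraph.wellformed'[OF assms] by auto

lemma pendant_blocks_if_digraph_iso:
  assumes wf: "pair_wf_digraph G" and iso: "digraph_iso (with_proj G) (with_proj G')"
    and pb: "pendant_blocks G' I b c l"
  shows "\<exists>b c l. pendant_blocks G I b c l"
proof -
  interpret pair_wf_digraph G by fact
  obtain f where f: "inj_on f (pverts G)" "pverts G' = f ` pverts G"
    "parcs G' = map_prod f f ` parcs G"
    using iso unfolding digraph_iso_with_proj_iff[OF wf] by blast
  define g where "g = the_inv_into (pverts G) f"
  have g: "g y \<in> pverts G" "f (g y) = y" if "y \<in> pverts G'" for y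
    using that f(1,2) by (auto simp: g_def the_inv_into_into f_the_inv_into_f)
  have arc: "(x, y) \<in> parcs G \<longleftrightarrow> (f x, f y) \<in> parcs G'" if "x \<in> pverts G" "y \<in> pverts G" for x y
    using that f(1) unfolding f(3) by (auto dest: inj_onD wellformed')
  have V: "b i \<in> pverts G'" "c i \<in> pverts G'" "l i \<in> pverts G'" if "i \<in> I" for i
    using that pendant_blocksD(1)[OF pb] by blast+
  have nbhd: "open_neighborhood G (g y) = g ` open_neighborhood G' y" if y: "y \<in> pverts G'" for y
  proof -
    have "z \<in> open_neighborhood G (g y) \<longleftrightarrow> z \<in> pverts G \<and> f z \<in> open_neighborhood G' y" for z
      using arc[OF g(1)[OF y], of z] g(2)[OF y]
      by (auto simp: open_neighborhood_def dest: wellformed')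
    moreover have "open_neighborhood G' y \<subseteq> pverts G'"
      unfolding open_neighborhood_def f(2,3) by (auto dest: wellformed')
    moreover have "g (f z) = z" if "z \<in> pverts G" for z
      using that f(1) by (simp add: g_def the_inv_into_f_f)
    ultimately show ?thesis
      using g by (intro set_eqI) (auto simp: image_iff subset_iff intro!: bexI[of _ "f _"])
  qed
  have blockV: "{b i, c i, l i} \<subseteq> pverts G'" if "i \<in> I" for i
    using V[OF that] by blast
  have "pendant_blocks G I (g \<circ> b) (g \<circ> c) (g \<circ> l)"
    unfolding pendant_blocks_def
  proof (intro conjI ballI)
    have "pverts G = g ` pverts G'"
      unfolding f(2) image_image using f(1) by (simp add: g_def the_inv_into_f_f)
    then show "pverts G = (\<Union>i\<in>I. {(g \<circ> b) i, (g \<circ> c) i, (g \<circ> l) i})"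
      unfolding pendant_blocksD(1)[OF pb] by auto
    have inj: "inj_on g (pverts G')"
      by (rule inj_on_inverseI[of _ f]) (rule g(2))
    have "g ` {b i, c i, l i} \<inter> g ` {b j, c j, l j} = {}" if "i \<in> I" "j \<in> I" "i \<noteq> j" for i j
      using inj_on_image_Int[OF inj blockV blockV, OF that(1,2)] pendant_blocksD(2)[OF pb that(1,2)] that(3)
      by blast
    then show "disjoint_family_on (\<lambda>i. {(g \<circ> b) i, (g \<circ> c) i, (g \<circ> l) i}) I"
      unfolding disjoint_family_on_def by simp
  next
    fix i assume i: "i \<in> I"
    have G': "open_neighborhood G' (l i) = {c i}" "open_neighborhood G' (c i) = {l i, b i}"
      using pb i by (simp_all add: pendant_blocks_def)
    show "(g \<circ> b) i \<noteq> (g \<circ> l) i"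
      using g(2)[OF V(1)[OF i]] g(2)[OF V(3)[OF i]] pendant_blocksD(3)[OF pb i] by force
    show "open_neighborhood G ((g \<circ> l) i) = {(g \<circ> c) i}"
      using nbhd V[OF i] G' by simp
    show "open_neighborhood G ((g \<circ> c) i) = {(g \<circ> l) i, (g \<circ> b) i}"
      using nbhd V[OF i] G' by simp
  qed
  then show ?thesis by blast
qed

definition induced_pair_subgraph :: "'a pair_pre_digraph \<Rightarrow> 'a set \<Rightarrow> 'a pair_pre_digraph" where
  "induced_pair_subgraph G W = \<lparr> pverts = W, parcs = parcs G \<inter> W \<times> W \<rparr>"

lemma induced_pair_subgraph_simps [simp]:
  "pverts (induced_pair_subgraph G W) = W"
  "parcs (induced_pair_subgraph G W) = parcs G \<inter> W \<times> W"
  by (simp_all add: induced_pair_subgraph_def)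

text \<open>
  The vertices \<open>b i\<close> name themselves and the two path vertices of their block, so that no
  reference to the index set remains.
\<close>

lemma (in pair_graph) digraph_iso_attach_if_pendant_blocks:
  assumes pb: "pendant_blocks G I b c l"
  shows "digraph_iso (with_proj G) (with_proj (attach_pendant_P2 (induced_pair_subgraph G (b ` I))))"
proof -
  let ?H = "induced_pair_subgraph G (b ` I)"
  note V = pendant_blocksD(1)[OF pb] and eq = pendant_blocksD(2)[OF pb]
    and arcs = pendant_blocksD(4,5)[OF pb]
  have arcs': "(z, l i) \<in> parcs G \<longleftrightarrow> z = c i" "(z, c i) \<in> parcs G \<longleftrightarrow> z = l i \<or> z = b i"
    if "i \<in> I" for i z
    using arcs[OF that] arcs_symmetric by blast+
  have distinct: "b i \<noteq> c i" "c i \<noteq> l i" "b i \<noteq> l i" if "i \<in> I" for i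
    using arcs[OF that] no_loops'[of "c i" "b i"] no_loops'[of "c i" "l i"] pendant_blocksD(3)[OF pb that] by auto
  define f where "f z = (if z \<in> b ` I then Base z
      else if z \<in> c ` I then Mid (b (inv_into I c z)) else Leaf (b (inv_into I l z)))" for z
  have fb: "f (b i) = Base (b i)" if "i \<in> I" for i
    using that by (simp add: f_def)
  have fc: "f (c i) = Mid (b i)" if i: "i \<in> I" for i
  proof -
    have "c i \<notin> b ` I"
    proof
      assume "c i \<in> b ` I"
      then obtain j where "j \<in> I" "c i = b j" by blast
      moreover from this have "i = j" using eq[of i j "c i"] i by simp
      ultimately show False using distinct(1)[OF i] by simp
    qed
    moreover have "inv_into I c (c i) = i"
      using i eq by (intro inv_into_f_f inj_onI) auto
    ultimately show ?thesis using i by (simp add: f_def)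
  qed
  have fl: "f (l i) = Leaf (b i)" if i: "i \<in> I" for i
  proof -
    have "l i \<noteq> b j \<and> l i \<noteq> c j" if "j \<in> I" for j
      using eq[of i j "l i"] distinct(2,3)[OF i] i that by auto
    then have "l i \<notin> b ` I" "l i \<notin> c ` I" by auto
    moreover have "inv_into I l (l i) = i"
      using i eq by (intro inv_into_f_f inj_onI) auto
    ultimately show ?thesis using i by (simp add: f_def)
  qed
  note f = fb fc fl
  have b_inj: "i = j" if "i \<in> I" "j \<in> I" "b i = b j" for i j
    using eq[OF that(1,2), of "b i"] that(3) by simp
  have "inj_on f (pverts G)"
    unfolding V by (rule inj_onI) (auto simp: f dest: b_inj)
  moreover have "pverts (attach_pendant_P2 ?H) = f ` pverts G"
    unfolding V attach_pendant_P2_def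
    by (auto simp: f image_iff)
  moreover have "parcs (attach_pendant_P2 ?H) = map_prod f f ` parcs G"
  proof
    show "parcs (attach_pendant_P2 ?H) \<subseteq> map_prod f f ` parcs G"
    proof
      fix e assume "e \<in> parcs (attach_pendant_P2 ?H)"
      then consider (base) i j where "i \<in> I" "j \<in> I" "(b i, b j) \<in> parcs G" "e = (Base (b i), Base (b j))"
        | (pendant) i where "i \<in> I" "e \<in> {(Base (b i), Mid (b i)), (Mid (b i), Base (b i)),
            (Mid (b i), Leaf (b i)), (Leaf (b i), Mid (b i))}"
        unfolding attach_pendant_P2_def by auto
      then show "e \<in> map_prod f f ` parcs G"
      proof cases
        case base
        then show ?thesis using f by (intro image_eqI[of _ _ "(b i, b j)"]) simp_all
      next
        case pendant
        have "{(b i, c i), (c i, b i), (c i, l i), (l i, c i)} \<subseteq> parcs G"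
          using arcs arcs' pendant(1) by simp
        moreover have "e \<in> map_prod f f ` {(b i, c i), (c i, b i), (c i, l i), (l i, c i)}"
          using pendant f by simp
        ultimately show ?thesis by blast
      qed
    qed
    show "map_prod f f ` parcs G \<subseteq> parcs (attach_pendant_P2 ?H)"
    proof (intro image_subsetI)
      fix e assume e: "e \<in> parcs G"
      obtain x y where xy: "e = (x, y)" by fastforce
      obtain i j where i: "i \<in> I" "x \<in> {b i, c i, l i}" and j: "j \<in> I" "y \<in> {b j, c j, l j}"
        using e xy wellformed' V by blast
      show "map_prod f f e \<in> parcs (attach_pendant_P2 ?H)"
      \<comment> \<open>All other arcs stay within one block.\<close>
      proof (cases "x = b i \<and> y = b j")
        case True
        then show ?thesis
          using e xy i(1) j(1) f by (auto simp: attach_pendant_P2_def)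
      next
        case False
        have "y \<in> {b i, c i, l i} \<or> x \<in> {b j, c j, l j}"
          using False arcs[OF i(1)] arcs'[OF j(1)] e xy i(2) j(2) by auto
        then have "i = j" using eq i j by blast
        then have "e \<in> {(b i, c i), (c i, b i), (c i, l i), (l i, c i)}"
          using False arcs[OF i(1)] arcs'[OF i(1)] distinct[OF i(1)] e xy i(2) j(2) by auto
        then show ?thesis
          using i(1) f by (auto simp: attach_pendant_P2_def)
      qed
    qed
  qed
  ultimately show ?thesis
    unfolding digraph_iso_with_proj_iff[OF pair_wf_digraph] by blast
qed

context simple_tree begin

text \<open>
  Projecting each block to its vertex \<open>b i\<close> turns a walk into one within the vertices \<open>b i\<close>, since
  blocks are joined to one another only at these vertices.
\<close>

lemma rtrancl_base_vertices:
  assumes pb: "pendant_blocks T I b c l" and i: "i \<in> I"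
    and z: "(b i, z) \<in> (parcs T)\<^sup>*"
  shows "\<exists>j\<in>I. z \<in> {b j, c j, l j} \<and> (b i, b j) \<in> (parcs T \<inter> b ` I \<times> b ` I)\<^sup>*"
  using z
proof (induction rule: rtrancl_induct)
  case base
  then show ?case using i by blast
next
  case (step y z)
  then obtain j where j: "j \<in> I" "y \<in> {b j, c j, l j}"
    "(b i, b j) \<in> (parcs T \<inter> b ` I \<times> b ` I)\<^sup>*" by blast
  have "z \<in> pverts T" using step wellformed' by blast
  then obtain k where k: "k \<in> I" "z \<in> {b k, c k, l k}"
    unfolding pendant_blocksD(1)[OF pb] by blast
  note arcs = pendant_blocksD(4,5)[OF pb]
  show ?case
  proof (cases "y = b j \<and> z = b k")
    case True
    then have "(b j, b k) \<in> parcs T \<inter> b ` I \<times> b ` I" using step j k by blast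
    then show ?thesis using j k by (meson rtrancl_into_rtrancl)
  next
    case False
    have "(z, y) \<in> parcs T" using step arcs_symmetric by blast
    then have "z \<in> {b j, c j, l j} \<or> y \<in> {b k, c k, l k}"
      using False arcs[OF j(1)] arcs[OF k(1)] step(2) j(2) k(2) by auto
    then have "j = k" using pendant_blocksD(2)[OF pb j(1) k(1)] j k by blast
    then show ?thesis using j k by blast
  qed
qed

lemma undirected_tree_base_vertices:
  assumes pb: "pendant_blocks T I b c l"
  shows "undirected_tree (induced_pair_subgraph T (b ` I))"
proof -
  let ?H = "induced_pair_subgraph T (b ` I)"
  have sub: "b ` I \<subseteq> pverts T" using pendant_blocksD(1)[OF pb] by blast
  interpret H: pair_graph ?H
  proof
    show "finite (pverts ?H)" "finite (parcs ?H)"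
      using sub pair_finite_verts pair_finite_arcs
      by (auto intro: finite_subset[OF sub])
    show "symmetric ?H"
      using arcs_symmetric by (auto simp: symmetric_def intro!: symI)
  qed (use arc_neq in auto)
  have "I \<noteq> {}" using verts_nonempty pendant_blocksD(1)[OF pb] by auto
  moreover have "(b i, b j) \<in> (parcs T \<inter> b ` I \<times> b ` I)\<^sup>*" if ij: "i \<in> I" "j \<in> I" for i j
  proof -
    have "(b i, b j) \<in> (parcs T)\<^sup>*" using rtrancl_verts sub ij by blast
    then obtain k where "k \<in> I" "b j \<in> {b k, c k, l k}" "(b i, b k) \<in> (parcs T \<inter> b ` I \<times> b ` I)\<^sup>*"
      using rtrancl_base_vertices[OF pb ij(1)] by blast
    moreover have "j = k" using calculation pendant_blocksD(2)[OF pb ij(2)] by blast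
    ultimately show ?thesis by simp
  qed
  ultimately have "Digraph_Component.connected (with_proj ?H)"
    unfolding H.connected_iff_rtrancl by auto
  moreover have "subgraph (with_proj ?H) (with_proj T)"
    using sub H.wf_digraph wf_digraph
    by (auto simp: subgraph_def compatible_def)
  then have "\<not> (\<exists>p. pre_digraph.cycle (with_proj ?H) p \<and> 3 \<le> length p)"
    using subgraph_cycle undirected_tree unfolding undirected_tree_def by blast
  ultimately show ?thesis
    unfolding undirected_tree_def using H.pair_graph by blast
qed

lemma ex_neighbour:
  assumes "parcs T \<noteq> {}" "z \<in> pverts T"
  obtains s where "(z, s) \<in> parcs T"
proof -
  obtain u v where "(u, v) \<in> parcs T" using assms by auto
  then have "(z, u) \<in> (parcs T)\<^sup>*" using rtrancl_verts assms(2) wellformed' by blast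
  then show ?thesis using that \<open>(u, v) \<in> parcs T\<close> by (cases rule: converse_rtranclE) auto
qed

lemma verts_eq_if_closed:
  assumes "u \<in> S" "S \<subseteq> pverts T" "\<And>x y. x \<in> S \<Longrightarrow> (x, y) \<in> parcs T \<Longrightarrow> y \<in> S"
  shows "pverts T = S"
proof -
  have "z \<in> S" if "z \<in> pverts T" for z
  proof -
    have "(u, z) \<in> (parcs T)\<^sup>*" using rtrancl_verts assms(1,2) that by blast
    then show ?thesis by (induction rule: rtrancl_induct) (use assms in auto)
  qed
  then show ?thesis using assms(2) by blast
qed

section \<open>The characterisation\<close>

text \<open>
  The blocks are the hoods of a packing.  A packed hood without a vertex \<open>w\<close> consists of two vertices
  with no neighbours outside; by connectedness it is the whole tree, which the assumption on the
  number of vertices excludes.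
\<close>

lemma pendant_blocks_if_well_ve_dominated:
  assumes well: "well_ve_dominated T" and reduced: "reduced T" and arcs: "parcs T \<noteq> {}"
    and card: "card (pverts T) \<noteq> 2"
  shows "\<exists>(I :: ('a \<times> 'a) set) b c l. pendant_blocks T I b c l"
proof -
  obtain P D\<^sub>0 where P: "P \<subseteq> parcs T" "disjoint_family_on (edge_hood T) P"
    and D\<^sub>0: "ve_dominating_set T D\<^sub>0" "card D\<^sub>0 \<le> card P"
    by (rule hood_packing)
  note rep = minimal_sets_are_packing_representatives[OF well P D\<^sub>0]
  have "\<exists>c l w. {fst e, snd e} = {c, l} \<and> nbhd l = {c} \<and> nbhd c = {l, w} \<and> w \<noteq> l" if e: "e \<in> P" for e
  proof -
    have e': "(fst e, snd e) \<in> parcs T" using e P(1) by auto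
    show ?thesis
    proof (rule pendant_edge_if_one_representative[OF reduced e'])
      fix D x y
      assume "minimal_ve_dominating_set T D" "x \<in> D" "y \<in> D"
        "x \<in> edge_hood T (fst e, snd e)" "y \<in> edge_hood T (fst e, snd e)"
      then show "x = y" using rep(2)[OF _ e] by simp
    next
      fix c l assume cl: "nbhd l = {c}" "nbhd c = {l}"
      then have "(l, c) \<in> parcs T" by (auto simp: open_neighborhood_def)
      then have "pverts T = {l, c}"
        using cl by (intro verts_eq_if_closed[of l]) (auto simp: open_neighborhood_def dest: wellformed')
      then show ?thesis using card arc_neq[OF \<open>(l, c) \<in> parcs T\<close>] by simp
    qed blast
  qed
  then obtain c l w where clw: "\<And>e. e \<in> P \<Longrightarrow> {fst e, snd e} = {c e, l e} \<and>
      nbhd (l e) = {c e} \<and> nbhd (c e) = {l e, w e} \<and> w e \<noteq> l e"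
    by metis
  have hood: "edge_hood T e = {w e, c e, l e}" if "e \<in> P" for e
  proof -
    have "edge_hood T e = cnbhd (c e) \<union> cnbhd (l e)"
      using clw[OF that] unfolding edge_hood_def by (metis doubleton_eq_iff sup_commute)
    then show ?thesis
      using clw[OF that] by (auto simp: closed_neighborhood_def)
  qed
  have "pverts T = (\<Union>e\<in>P. {w e, c e, l e})"
  proof
    show "(\<Union>e\<in>P. {w e, c e, l e}) \<subseteq> pverts T"
      using edge_hood_subset P(1) hood by blast
    show "pverts T \<subseteq> (\<Union>e\<in>P. {w e, c e, l e})"
    proof
      fix z assume "z \<in> pverts T"
      then obtain s where "(z, s) \<in> parcs T" using ex_neighbour[OF arcs] by blast
      then obtain D where D: "minimal_ve_dominating_set T D" "z \<in> D" by (rule vertex_in_minimal_set)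
      then obtain e where "e \<in> P" "z \<in> edge_hood T e" using rep(1)[OF D(1)] by blast
      then show "z \<in> (\<Union>e\<in>P. {w e, c e, l e})" using hood[of e] by blast
    qed
  qed
  moreover have "disjoint_family_on (\<lambda>e. {w e, c e, l e}) P"
    using P(2) hood unfolding disjoint_family_on_def by simp
  ultimately have "pendant_blocks T P w c l"
    unfolding pendant_blocks_def using clw by simp
  then show ?thesis by blast
qed

text \<open>
  A single block is a path on three vertices, whose two leaves are false twins.
\<close>

lemma two_blocks_if_reduced:
  assumes reduced: "reduced T" and pb: "pendant_blocks T I b c l"
  shows "2 \<le> card (b ` I)"
proof -
  have "b ` I \<subseteq> pverts T" using pendant_blocksD(1)[OF pb] by blast
  then have "finite (b ` I)" using pair_finite_verts by (rule finite_subset)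
  moreover have "I \<noteq> {}" using verts_nonempty pendant_blocksD(1)[OF pb] by auto
  moreover have "\<not> is_singleton (b ` I)"
  proof
    assume "is_singleton (b ` I)"
    then obtain x where x: "b ` I = {x}" by (auto simp: is_singleton_def)
    obtain i where i: "i \<in> I" using \<open>I \<noteq> {}\<close> by blast
    have "j = i" if "j \<in> I" for j
    proof -
      have "b j = x" "b i = x" using x i that by blast+
      then show ?thesis using pendant_blocksD(2)[OF pb that i, of x] by simp
    qed
    then have "I = {i}" using i by blast
    then have V: "pverts T = {b i, c i, l i}"
      using pendant_blocksD(1)[OF pb] by simp
    note arcs = pendant_blocksD(4,5)[OF pb i]
    have "nbhd (b i) = {c i}"
    proof
      show "{c i} \<subseteq> nbhd (b i)" using arcs arc_sym by auto
      show "nbhd (b i) \<subseteq> {c i}"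
      proof
        fix z assume "z \<in> nbhd (b i)"
        then have z: "(b i, z) \<in> parcs T" "(z, b i) \<in> parcs T" using arc_sym by simp_all
        moreover have "(c i, b i) \<in> parcs T" using arcs by simp
        ultimately have "z \<noteq> b i" "z \<noteq> l i"
          using arc_neq[OF z(1)] arc_neq[of "c i" "b i"] arcs(1)[of "b i"] by auto
        moreover have "z \<in> pverts T" using z wellformed' by blast
        ultimately show "z \<in> {c i}" unfolding V by simp
      qed
    qed
    moreover have "nbhd (l i) = {c i}" using pb i by (simp add: pendant_blocks_def)
    ultimately have "false_twins T (b i) (l i)"
      using V pendant_blocksD(3)[OF pb i] by (auto simp: false_twins_def)
    then show False using reduced by (auto simp: reduced_def)
  qed
  ultimately have "card (b ` I) \<noteq> 0" "card (b ` I) \<noteq> 1"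
    by (simp_all add: is_singleton_altdef)
  then show ?thesis by linarith
qed

lemma digraph_iso_path_1_iff:
  "digraph_iso (with_proj T) (with_proj (path_graph 1)) \<longleftrightarrow> card (pverts T) = 1"
proof
  assume "digraph_iso (with_proj T) (with_proj (path_graph 1))"
  then show "card (pverts T) = 1"
    using card_eq_if_digraph_iso[OF pair_wf_digraph] by (force simp: path_graph_def)
next
  assume "card (pverts T) = 1"
  then obtain u where u: "pverts T = {u}" by (auto simp: card_1_singleton_iff)
  then have "e \<notin> parcs T" for e
    using arc_neq[of "fst e" "snd e"] wellformed'[of "fst e" "snd e"] by auto
  then have "parcs T = {}" by blast
  then show "digraph_iso (with_proj T) (with_proj (path_graph 1))"
    unfolding digraph_iso_with_proj_iff[OF pair_wf_digraph]
    by (intro exI[of _ "\<lambda>_. 0"]) (auto simp: u path_graph_def)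
qed

lemma digraph_iso_path_2_iff:
  "digraph_iso (with_proj T) (with_proj (path_graph 2)) \<longleftrightarrow> card (pverts T) = 2"
proof
  assume "digraph_iso (with_proj T) (with_proj (path_graph 2))"
  then show "card (pverts T) = 2"
    using card_eq_if_digraph_iso[OF pair_wf_digraph] by (force simp: path_graph_def)
next
  assume "card (pverts T) = 2"
  then obtain u v where uv: "pverts T = {u, v}" "u \<noteq> v" by (auto simp: card_2_iff)
  have "parcs T \<noteq> {}"
    using rtrancl_verts[of u v] uv by auto
  moreover have "e = (u, v) \<or> e = (v, u)" if "e \<in> parcs T" for e
    using that uv arc_neq[of "fst e" "snd e"] wellformed'[of "fst e" "snd e"]
    by (cases e) auto
  ultimately have "parcs T = {(u, v), (v, u)}"
    using arc_sym[of u v] by blast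
  then show "digraph_iso (with_proj T) (with_proj (path_graph 2))"
    unfolding digraph_iso_with_proj_iff[OF pair_wf_digraph]
    using uv by (intro exI[of _ "\<lambda>x. if x = u then 0 else 1"]) (auto simp: path_graph_def)
qed

end

theorem theorem20:
  fixes T :: "'a pair_pre_digraph"
  assumes "undirected_tree T"
    and "reduced T"
  shows "well_ve_dominated T \<longleftrightarrow>
      (digraph_iso (with_proj T) (with_proj (path_graph 1)) \<or>
       digraph_iso (with_proj T) (with_proj (path_graph 2))) \<or>
      pendant_P2_attachment_of_tree T"
proof -
  interpret simple_tree T by standard fact
  have "card (pverts T) \<noteq> 0" using verts_nonempty pair_finite_verts by simp
  then have small: "digraph_iso (with_proj T) (with_proj (path_graph 1)) \<or>
      digraph_iso (with_proj T) (with_proj (path_graph 2)) \<longleftrightarrow> card (pverts T) \<le> 2"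
    unfolding digraph_iso_path_1_iff digraph_iso_path_2_iff by linarith
  have "pendant_P2_attachment_of_tree T" if well: "well_ve_dominated T" and "2 < card (pverts T)"
  proof -
    have "parcs T \<noteq> {}"
    proof
      assume "parcs T = {}"
      moreover obtain u where "u \<in> pverts T" using verts_nonempty by blast
      ultimately have "pverts T = {u}" by (intro verts_eq_if_closed) auto
      then show False using \<open>2 < card (pverts T)\<close> by simp
    qed
    then obtain I :: "('a \<times> 'a) set" and b c l where "pendant_blocks T I b c l"
      using pendant_blocks_if_well_ve_dominated[OF well assms(2)] \<open>2 < card (pverts T)\<close> by auto
    then show ?thesis
      unfolding pendant_P2_attachment_of_tree_def
      using undirected_tree_base_vertices digraph_iso_attach_if_pendant_blocks
        two_blocks_if_reduced[OF assms(2)]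
      by (intro exI[of _ "induced_pair_subgraph T (b ` I)"] conjI) simp_all
  qed
  moreover have "well_ve_dominated T" if attached: "pendant_P2_attachment_of_tree T"
  proof -
    obtain H :: "'a pair_pre_digraph" where "undirected_tree H"
      and iso: "digraph_iso (with_proj T) (with_proj (attach_pendant_P2 H))"
      using attached unfolding pendant_P2_attachment_of_tree_def by blast
    then interpret H: simple_tree H by unfold_locales
    obtain b c l where "pendant_blocks T (pverts H) b c l"
      using pendant_blocks_if_digraph_iso[OF pair_wf_digraph iso]
        pendant_blocks_attach[OF H.pair_wf_digraph] by blast
    then show ?thesis
      using card_minimal_set_pendant_blocks unfolding well_ve_dominated_def by metis
  qed
  ultimately show ?thesis
    unfolding small using well_ve_dominated_if_card_le_2 by (meson not_le)
qed

end
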